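(* $${}_2F_1\left(\tfrac12,\tfrac34;1;\tfrac1{81}\right)=\frac{9}{100}\,\frac{\sqrt2\;5^{3/4}\,\Gamma(1/4)^2}{\pi^{3/2}}.$$
   Context: For complex $a,b,c$ with $c\notin\{0,-1,-2,\dots\}$ and $|x|<1$, ${}_2F_1(a,b;c;x)=\sum_{n\ge 0}\frac{(a,n)(b,n)}{(c,n)(1,n)}x^n$ denotes Gauss's hypergeometric series, where $(\alpha,n)=\alpha(\alpha+1)\cdots(\alpha+n-1)$, $(\alpha,0)=1$. *)

theory Defs
  imports "HOL-Analysis.Analysis"
begin

text \<open>
  The parameter \<open>c\<close> must not be a non-positive integer; otherwise a term with a vanishing
  denominator is read as \<open>0\<close>.
  The value is the sum of the series only where the series converges, e.g. for \<open>norm x < 1\<close>.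
\<close>

definition hypergeom_2F1 :: "complex \<Rightarrow> complex \<Rightarrow> complex \<Rightarrow> complex \<Rightarrow> complex" where
  "hypergeom_2F1 a b c x =
     (\<Sum>n. pochhammer a n * pochhammer b n / (pochhammer c n * pochhammer 1 n) * x ^ n)"

end

theory Submission
  imports Defs
begin

text \<open>
  Wallis' integral turns the series into \<open>2/\<pi> \<integral> (1 - x sin\<^sup>2 t)\<^bsup>-3/4\<^esup> dt\<close> over \<open>[0, \<pi>/2]\<close>.
  For \<open>1 - x = k\<^sup>4\<close> this is a period of a curve of genus 3; with \<open>z\<^sup>4 = 1 - x sin\<^sup>2 t\<close> the
  involution \<open>z \<mapsto> k/z\<close> folds it to a complete elliptic integral of squared modulus
  \<open>(1 - k)\<^sup>2 / (2 (1 + k\<^sup>2))\<close>. For \<open>x = 1/81\<close> this is the singular modulus of period ratio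
  \<open>5i\<close>, so an explicit transformation of degree 5 leads to the lemniscatic integral, which is
  a Beta value.
\<close>

section \<open>From the hypergeometric series to an integral\<close>

text \<open>Integrating the derivative of \<open>sin t ^ (2*n+1) * cos t\<close>, which vanishes at
  both ends, gives the Wallis recurrence (2n+2) I(n+1) = (2n+1) I(n). The quotient (n + 1/2) / (n +
  1) is that of consecutive values of \<open>pochhammer (1/2) n / fact n\<close>.\<close>

lemma has_integral_sin_even_power:
  "((\<lambda>t. sin t ^ (2 * n)) has_integral (pi / 2 * (pochhammer (1/2) n / fact n))) {0..pi/2}"
proof (induction n)
  case 0
  show ?case
    using has_integral_const_real[of "1::real" 0 "pi/2"] by simp
next
  case (Suc n)
  have deriv: "((\<lambda>t. sin t ^ (2*n+1) * cos t) has_vector_derivative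
      ((2*n+1) * sin t ^ (2*n) - (2*n+2) * sin t ^ (2*n+2))) (at t within {0..pi/2})" for t :: real
  proof -
    have "((\<lambda>t. sin t ^ (2*n+1) * cos t) has_real_derivative
      ((2*n+1) * sin t ^ (2*n) * cos t * cos t - sin t ^ (2*n+1) * sin t)) (at t within {0..pi/2})"
      by (rule derivative_eq_intros refl | simp)+
    also have "(2*n+1) * sin t ^ (2*n) * cos t * cos t - sin t ^ (2*n+1) * sin t
        = (2*n+1) * sin t ^ (2*n) * (cos t)\<^sup>2 - sin t ^ (2*n) * (sin t)\<^sup>2"
      by (simp add: power2_eq_square)
    also have "\<dots> = (2*n+1) * sin t ^ (2*n) - (2*n+2) * sin t ^ (2*n+2)"
      unfolding cos_squared_eq by (simp add: power_add algebra_simps power2_eq_square)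
    finally show ?thesis
      by (simp add: has_real_derivative_iff_has_vector_derivative)
  qed
  have "((\<lambda>t. (2*n+1) * sin t ^ (2*n) - (2*n+2) * sin t ^ (2*n+2)) has_integral 0) {0..pi/2}"
    using fundamental_theorem_of_calculus[OF _ deriv] by simp
  from has_integral_diff[OF has_integral_mult_right[OF Suc, of "2*n+1"] this]
  have "((\<lambda>t. (2*n+2) * sin t ^ (2*n+2)) has_integral
      ((2*n+1) * (pi / 2 * (pochhammer (1/2) n / fact n)))) {0..pi/2}"
    by simp
  from has_integral_mult_right[OF this, of "1/(2*n+2)"]
  have "((\<lambda>t. sin t ^ (2*n+2)) has_integral
      (1/(2*n+2) * ((2*n+1) * (pi / 2 * (pochhammer (1/2) n / fact n))))) {0..pi/2}"
    by (rule has_integral_eq[rotated]) (simp del: of_nat_add of_nat_mult of_nat_Suc)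
  also have "1/(2*n+2) * ((2*n+1) * (pi / 2 * (pochhammer (1/2) n / fact n)))
    = pi / 2 * (pochhammer (1/2) (Suc n) / fact (Suc n))"
    by (simp add: pochhammer_rec' field_simps)
  finally show ?case by simp
qed

text \<open>The integrand is expanded by the binomial series in \<open>x * (sin t)\<^sup>2\<close>
  and integrated term by term. The series at \<open>x\<close> itself is a convergent majorant
  independent of \<open>t\<close>, and the Wallis integral supplies the factor
  \<open>pochhammer (1/2) n / fact n\<close>.\<close>

lemma hypergeom_half_sums_integral:
  fixes a x :: real
  assumes a: "0 < a" and x: "0 \<le> x" "x < 1"
  shows "(\<lambda>n. pochhammer (1/2) n * pochhammer a n / (fact n * fact n) * x ^ n) sums
    (2 / pi * integral {0..pi/2} (\<lambda>t. (1 - x * (sin t)\<^sup>2) powr (- a)))"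
proof -
  have binom: "(\<lambda>n. pochhammer a n / fact n * y ^ n) sums (1 - y) powr (- a)"
    if "0 \<le> y" "y < 1" for y
  proof -
    have "(- a gchoose n) * (- y) ^ n = pochhammer a n / fact n * y ^ n" for n
    proof -
      have "(- 1) ^ n * (- y) ^ n = y ^ n"
        by (simp flip: power_mult_distrib)
      then show ?thesis
        by (simp add: gbinomial_pochhammer mult_ac)
    qed
    then show ?thesis
      using gen_binomial_real[of "- y" "- a"] that by simp
  qed
  define f where "f n t = pochhammer a n / fact n * (x * (sin t)\<^sup>2) ^ n" for n and t :: real
  have y: "0 \<le> x * (sin t)\<^sup>2" "x * (sin t)\<^sup>2 \<le> x" for t
    using x by (auto simp: mult_left_le abs_square_le_1)
  have f_sum: "(\<Sum>n. f n t) = (1 - x * (sin t)\<^sup>2) powr (- a)" for t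
    using binom[of "x * (sin t)\<^sup>2"] y[of t] x by (simp add: f_def sums_iff)
  have "uniform_limit {0..pi/2} (\<lambda>n t. \<Sum>i<n. f i t) (\<lambda>t. \<Sum>i. f i t) sequentially"
  proof (rule Weierstrass_m_test)
    show "summable (\<lambda>n. pochhammer a n / fact n * x ^ n)"
      using binom[OF x] by (rule sums_summable)
    show "norm (f n t) \<le> pochhammer a n / fact n * x ^ n" for n t
      using y[of t] pochhammer_pos[OF a, of n]
      by (auto simp: f_def abs_mult intro!: divide_right_mono mult_left_mono power_mono)
  qed
  then obtain I J where I: "\<And>n. ((\<lambda>t. \<Sum>i<n. f i t) has_integral I n) {0..pi/2}"
    and J: "((\<lambda>t. \<Sum>i. f i t) has_integral J) {0..pi/2}" and lim: "I \<longlonglongrightarrow> J"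
    by (rule uniform_limit_integral) (auto simp: f_def intro!: continuous_intros)
  have int_f: "(f n has_integral
      (pi / 2 * (pochhammer (1/2) n * pochhammer a n / (fact n * fact n) * x ^ n))) {0..pi/2}" for n
  proof -
    have "f n = (\<lambda>t. pochhammer a n / fact n * x ^ n * sin t ^ (2 * n))"
      by (simp add: f_def fun_eq_iff power_mult_distrib power_mult)
    then show ?thesis
      using has_integral_mult_right[OF has_integral_sin_even_power[of n],
        of "pochhammer a n / fact n * x ^ n"]
      by (simp add: field_simps)
  qed
  have I_eq: "I = (\<lambda>n. \<Sum>i<n. pi / 2 * (pochhammer (1/2) i * pochhammer a i / (fact i * fact i) * x ^ i))"
    by (rule ext, rule has_integral_unique[OF I has_integral_sum[OF finite_lessThan int_f]])
  have "(\<lambda>n. pi / 2 * (pochhammer (1/2) n * pochhammer a n / (fact n * fact n) * x ^ n)) sums J"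
    using lim unfolding I_eq sums_def .
  from sums_mult[OF this, of "2/pi"] show ?thesis
    using J by (simp add: f_sum integral_unique mult.assoc)
qed

section \<open>The lemniscatic integral as a Beta value\<close>

text \<open>The substitution v = 4 t^4 / (1 + t^4)^2 maps [0,1] increasingly onto itself. Since v is
  a fourth power divided by (1 + t^4)^2 and 1 - v is the square of (1 - t^4) / (1 + t^4), it pulls
  the integrand of Beta(1/4, 1/2) back to a multiple of 1 / sqrt(1 + t^4).\<close>

lemma integral_lemniscate:
  "integral {0..1} (\<lambda>t::real. 1 / sqrt (1 + t ^ 4)) = (Gamma (1/4))\<^sup>2 / (8 * sqrt pi)"
proof -
  define g g' :: "real \<Rightarrow> real" where "g t = 4 * t ^ 4 / (1 + t ^ 4)\<^sup>2"
    and "g' t = 16 * t ^ 3 * (1 - t ^ 4) / (1 + t ^ 4) ^ 3" for t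
  define f :: "real \<Rightarrow> real" where "f v = v powr (1/4 - 1) * (1 - v) powr (1/2 - 1)" for v
  have pos: "1 + t ^ 4 > 0" for t :: real
    by (simp add: add_pos_nonneg)
  have lt1: "t ^ 4 < 1" if "0 < t" "t < 1" for t :: real
    using that by (simp add: power_less_one_iff)
  have deriv: "(g has_real_derivative g' t) (at t within A)" for t A
    unfolding g_def g'_def using pos[of t]
    by (auto intro!: derivative_eq_intros simp: divide_simps) algebra
  have mono: "g s < g t" if "0 \<le> s" "s < t" "t \<le> 1" for s t
  proof (rule DERIV_pos_imp_increasing_open[OF \<open>s < t\<close>])
    show "\<exists>y. (g has_real_derivative y) (at u) \<and> 0 < y" if "s < u" "u < t" for u
      using deriv[of u UNIV] pos[of u] lt1[of u] that \<open>0 \<le> s\<close> \<open>t \<le> 1\<close>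
      by (intro exI[of _ "g' u"]) (auto simp: g'_def)
    show "continuous_on {s..t} g"
      using deriv by (intro DERIV_continuous_on)
  qed
  have g01: "g 0 = 0" "g 1 = 1" by (simp_all add: g_def)
  have inj: "inj_on g {0<..<1}"
    by (rule linorder_inj_onI) (auto dest: mono[rotated])
  have image: "g ` {0<..<1} = {0<..<1}"
  proof (intro equalityI subsetI)
    fix v assume "v \<in> g ` {0<..<1}"
    then show "v \<in> {0<..<1}" using mono[of 0] mono[of _ 1] g01 by fastforce
  next
    fix v :: real assume v: "v \<in> {0<..<1}"
    have "\<exists>t\<ge>0. t \<le> 1 \<and> g t = v"
      using v g01 by (intro IVT') (auto intro: DERIV_continuous_on deriv)
    then obtain t where "0 \<le> t" "t \<le> 1" "g t = v" by blast
    with v g01 show "v \<in> g ` {0<..<1}"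
      by (intro image_eqI[of _ _ t]) (auto simp: less_le)
  qed
  \<comment> \<open>Only the open interval is used: at both ends \<open>g'\<close> vanishes, so the
    left side is 0 there while the right side is not.\<close>
  have integrand: "\<bar>g' t\<bar> * f (g t) = 4 * sqrt 2 * (1 / sqrt (1 + t ^ 4))" if t: "t \<in> {0<..<1}" for t
  proof -
    define w where "w = sqrt (1 + t ^ 4)"
    have w: "w > 0" "w\<^sup>2 = 1 + t ^ 4" using pos[of t] by (auto simp: w_def)
    have t': "0 < t" "t < 1" "t ^ 4 < 1" using t lt1 by auto
    \<comment> \<open>As a fourth power, \<open>g t\<close> raised to -3/4 becomes a rational
      expression in \<open>t\<close> and \<open>w\<close>.\<close>
    have "g t = (sqrt 2 * t / w) ^ 4"
    proof -
      have "sqrt 2 ^ 4 = ((sqrt 2)\<^sup>2)\<^sup>2" "w ^ 4 = (w\<^sup>2)\<^sup>2"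
        by (simp_all only: flip: power_mult) simp_all
      then show ?thesis
        by (simp add: g_def power_mult_distrib power_divide w(2))
    qed
    also have "\<dots> = (sqrt 2 * t / w) powr 4"
      using t' w by (subst powr_numeral) auto
    finally have "g t powr (1/4 - 1) = (sqrt 2 * t / w) powr (- 3)"
      by (simp add: powr_powr)
    also have "\<dots> = inverse ((sqrt 2 * t / w) ^ 3)"
      using t' w by (simp add: powr_minus powr_numeral)
    finally have 1: "g t powr (1/4 - 1) = w ^ 3 / (2 * sqrt 2 * t ^ 3)"
      using t' w by (simp add: power_mult_distrib power_divide field_simps power3_eq_cube)
    have "1 - g t = ((1 - t ^ 4) / w\<^sup>2)\<^sup>2"
    proof -
      have "(1 - t ^ 4)\<^sup>2 = (1 + t ^ 4)\<^sup>2 - 4 * t ^ 4" by algebra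
      then show ?thesis
        using pos[of t] by (simp add: g_def w(2) power_divide divide_simps)
    qed
    then have "(1 - g t) powr (1/2 - 1) = inverse ((1 - t ^ 4) / w\<^sup>2)"
      using t' w by (simp add: powr_minus powr_half_sqrt real_sqrt_divide)
    then have 2: "(1 - g t) powr (1/2 - 1) = w\<^sup>2 / (1 - t ^ 4)"
      by simp
    have 3: "\<bar>g' t\<bar> = 16 * t ^ 3 * (1 - t ^ 4) / w ^ 6"
      using t' w unfolding g'_def w(2)[symmetric] by (simp flip: power_mult)
    have "\<bar>g' t\<bar> * f (g t) = 8 / (sqrt 2 * w)"
      unfolding f_def 1 2 3 using t' w by (simp add: divide_simps) algebra
    also have "\<dots> = 4 * sqrt 2 * (1 / w)"
      using w by (simp add: field_simps)
    finally show ?thesis by (simp add: w_def)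
  qed
  have "(f has_integral Beta (1/4) (1/2)) {0<..<1}"
    using has_integral_Beta_real[of "1/4" "1/2"] by (simp add: f_def[abs_def] has_integral_Icc_iff_Ioo)
  then have "f absolutely_integrable_on (g ` {0<..<1}) \<and> integral (g ` {0<..<1}) f = Beta (1/4) (1/2)"
    unfolding image by (auto simp: f_def integral_unique intro!: nonnegative_absolutely_integrable_1)
  then have "integral {0<..<1} (\<lambda>t. \<bar>g' t\<bar> * f (g t)) = Beta (1/4) (1/2)"
    using has_absolute_integral_change_of_variables_1'[OF _ deriv inj, of f "Beta (1/4) (1/2)"] by simp
  also have "integral {0<..<1} (\<lambda>t. \<bar>g' t\<bar> * f (g t))
      = integral {0<..<1} (\<lambda>t. 4 * sqrt 2 * (1 / sqrt (1 + t ^ 4)))"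
    by (intro integral_cong integrand)
  also have "\<dots> = 4 * sqrt 2 * integral {0..1} (\<lambda>t. 1 / sqrt (1 + t ^ 4))"
    by (simp only: integral_mult_right integral_open_interval_real)
  finally have I: "4 * sqrt 2 * integral {0..1} (\<lambda>t. 1 / sqrt (1 + t ^ 4)) = Beta (1/4) (1/2)" .
  \<comment> \<open>Beta(1/4, 1/2) has Gamma(3/4) in its denominator; the reflection formula at 1/4
    eliminates it.\<close>
  have "Gamma (1/4 :: real) * Gamma (3/4) = sqrt 2 * pi"
  proof -
    have "complex_of_real (Gamma (1/4) * Gamma (3/4)) = Gamma (1/4) * Gamma (1 - 1/4)"
      by (simp flip: Gamma_complex_of_real)
    also have "\<dots> = of_real (pi / sin (pi / 4))"
      by (subst Gamma_reflection_complex) (simp add: mult.commute flip: sin_of_real)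
    finally have "Gamma (1/4) * Gamma (3/4) = pi / sin (pi / 4)"
      by (simp only: of_real_eq_iff)
    also have "\<dots> = sqrt 2 * pi"
      by (simp add: sin_45 field_simps)
    finally show ?thesis .
  qed
  then have G: "Gamma (3/4) = sqrt 2 * pi / Gamma (1/4 :: real)"
    using Gamma_real_pos[of "1/4"] by (auto simp: eq_divide_eq mult.commute)
  have "Beta (1/4) (1/2) = (Gamma (1/4))\<^sup>2 * sqrt pi / (sqrt 2 * pi)"
    by (simp add: Beta_def Gamma_one_half_real G power2_eq_square)
  also have "\<dots> = sqrt 2 * (Gamma (1/4))\<^sup>2 / (2 * sqrt pi)"
    by (simp add: field_simps)
  finally have "4 * sqrt 2 * integral {0..1} (\<lambda>t. 1 / sqrt (1 + t ^ 4))
      = 4 * sqrt 2 * ((Gamma (1/4))\<^sup>2 / (8 * sqrt pi))"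
    unfolding I by simp
  then show ?thesis by (subst (asm) mult_left_cancel) simp_all
qed

section \<open>Folding the genus 3 period to an elliptic integral\<close>

text \<open>With r = tan(phi/2) the integral on the right is half the complete elliptic integral of
  squared modulus (1 - \<open>\<beta>\<close>) / 2, where \<open>\<beta>\<close> = 2k / (1 + k^2).
  The range of \<open>t\<close> is cut at the fixed point of the involution, both pieces are
  parametrised by the same \<open>p\<close>, and their sum is a multiple of the elliptic
  differential in \<open>r\<close>.\<close>

lemma integral_quadratic_fold:
  fixes k :: real
  assumes k: "0 < k" "k < 1"
  shows "integral {0..pi/2} (\<lambda>t. (1 - (1 - k ^ 4) * (sin t)\<^sup>2) powr (- 3/4))
    = 4 / (k * sqrt (2 * (1 + k\<^sup>2))) *
      integral {0..1} (\<lambda>r. 1 / sqrt (r ^ 4 + 2 * (2 * k / (1 + k\<^sup>2)) * r\<^sup>2 + 1))"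
proof -
  define f where "f t = (1 - (1 - k ^ 4) * (sin t)\<^sup>2) powr (- 3/4)" for t :: real
  define \<beta> where "\<beta> = 2 * k / (1 + k\<^sup>2)"
  define h where "h r = 1 / sqrt (r ^ 4 + 2 * \<beta> * r\<^sup>2 + 1)" for r :: real
  \<comment> \<open>\<open>z p\<close> is the fourth root of 1 - (1 - k^4) sin^2 t at tan t = p/k;
    at cot t = k p that root is \<open>k / z p\<close>. \<open>E\<close> is the sum of the two
    pulled-back integrands.\<close>
  define A B z where "A p = 1 + k\<^sup>2 * p\<^sup>2" and "B p = k\<^sup>2 + p\<^sup>2"
    and "z p = (k\<^sup>2 * A p / B p) powr (1/4)" for p
  define E where "E p = (z p ^ 2 + k) / (B p * z p ^ 3)" for p
  have k4: "k ^ 4 < 1" using k by (simp add: power_less_one_iff)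
  have \<beta>: "\<beta> > 0" using k by (simp add: \<beta>_def add_pos_pos)
  have AB: "A p > 0" "B p > 0" for p
    using k by (simp_all add: A_def B_def add_pos_nonneg)
  have z0: "z p > 0" for p using AB[of p] k by (simp add: z_def)
  have z4: "z p ^ 4 = k\<^sup>2 * A p / B p" for p
  proof -
    have "z p ^ 4 = z p powr 4" using z0[of p] by (simp add: powr_numeral)
    also have "\<dots> = k\<^sup>2 * A p / B p" using AB[of p] k by (simp add: z_def powr_powr)
    finally show ?thesis .
  qed
  have root4: "(y ^ 4) powr (- 3/4) = 1 / y ^ 3" if "y > 0" for y :: real
  proof -
    have "(y ^ 4) powr (- 3/4) = (y powr 4) powr (- 3/4)"
      using that by (simp add: powr_numeral)
    also have "\<dots> = y powr (- 3)"
      by (simp add: powr_powr)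
    finally show ?thesis
      using that by (simp add: powr_minus powr_numeral field_simps)
  qed
  have cont_f: "continuous_on S f" for S
  proof -
    have "(1 - k ^ 4) * (sin t)\<^sup>2 < 1" for t :: real
    proof -
      have "(1 - k ^ 4) * (sin t)\<^sup>2 \<le> 1 - k ^ 4"
        using k4 by (intro mult_left_le) (auto simp: abs_square_le_1)
      then show ?thesis using k by (smt (verit) zero_less_power)
    qed
    then show ?thesis
      unfolding f_def[abs_def] by (intro continuous_intros) (smt (verit))
  qed

  \<comment> \<open>The two substitutions exchange \<open>z\<close> and \<open>k / z\<close>, and both pieces end at \<open>z = sqrt k\<close>, where \<open>p = 1\<close>.\<close>
  have "((\<lambda>p. (k / B p) *\<^sub>R f (arctan (p / k))) has_integral
      integral {arctan (0 / k)..arctan (1 / k)} f) {0..1}"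
  proof (rule has_integral_substitution)
    show "(\<lambda>p. arctan (p / k)) ` {0..1} \<subseteq> {arctan (0 / k)..arctan (1 / k)}"
      using k by (auto simp: arctan_monotone' divide_right_mono)
    show "((\<lambda>p. arctan (p / k)) has_real_derivative k / B p) (at p within {0..1})" for p
      using k AB[of p]
      by (auto intro!: derivative_eq_intros simp: B_def power_divide field_simps power2_eq_square)
  qed (use k in \<open>auto simp: arctan_monotone' cont_f\<close>)
  moreover have "f (arctan (p / k)) = 1 / z p ^ 3" for p
  proof -
    have "(sin (arctan (p / k)))\<^sup>2 = p\<^sup>2 / B p"
    proof -
      have "1 + (p / k)\<^sup>2 = B p / k\<^sup>2"
        using k by (simp add: B_def power_divide add_divide_distrib)
      then show ?thesis
        using k AB[of p] by (simp only: sin_arctan power_divide) simp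
    qed
    moreover have "1 - (1 - k ^ 4) * (p\<^sup>2 / B p) = z p ^ 4"
      unfolding z4 using AB(2)[of p] by (simp add: divide_simps) (simp add: A_def B_def; algebra)
    ultimately show ?thesis using root4[OF z0] by (simp add: f_def)
  qed
  ultimately have I1: "((\<lambda>p. k / B p * (1 / z p ^ 3)) has_integral
      integral {0..arctan (1 / k)} f) {0..1}"
    by simp

  have "((\<lambda>p. (- k / A p) *\<^sub>R f (pi / 2 - arctan (k * p))) has_integral
      (integral {pi / 2 - arctan (k * 0)..pi / 2 - arctan (k * 1)} f
       - integral {pi / 2 - arctan (k * 1)..pi / 2 - arctan (k * 0)} f)) {0..1}"
  \<comment> \<open>This substitution is decreasing, so the rule yields a difference of two
    integrals; the first runs over an empty interval and the second carries the minus sign.\<close>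
  proof (rule has_integral_substitution_general[of "{}"])
    show "(\<lambda>p. pi / 2 - arctan (k * p)) ` {0..1} \<subseteq> {pi / 2 - arctan (k * 1)..pi / 2 - arctan (k * 0)}"
      using k by (auto simp: arctan_le_iff)
    show "((\<lambda>p. pi / 2 - arctan (k * p)) has_real_derivative - k / A p) (at p within {0..1})" for p
      using k AB[of p]
      by (auto intro!: derivative_eq_intros simp: A_def power_mult_distrib field_simps)
    show "continuous_on {0..1} (\<lambda>p. pi / 2 - arctan (k * p))"
      by (intro continuous_intros)
  qed (use k in \<open>auto simp: cont_f\<close>)
  moreover have "f (pi / 2 - arctan (k * p)) = z p ^ 3 / k ^ 3" for p
  proof -
    have "(sin (pi / 2 - arctan (k * p)))\<^sup>2 = 1 / A p"
      using AB[of p] by (simp add: sin_diff cos_arctan power_divide A_def power_mult_distrib)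
    moreover have "1 - (1 - k ^ 4) * (1 / A p) = (k / z p) ^ 4"
      unfolding power_divide z4 using AB[of p] k
      by (simp add: divide_simps) (simp add: A_def B_def; algebra)
    ultimately show ?thesis
      using root4[of "k / z p"] z0[of p] k by (simp add: f_def power_divide)
  qed
  moreover have "{pi / 2..pi / 2 - arctan k} = {}"
    using k by simp
  moreover have "pi / 2 - arctan k = arctan (1 / k)"
    using k arctan_inverse[of k] by (simp add: inverse_eq_divide)
  ultimately have "((\<lambda>p. (- k / A p) * (z p ^ 3 / k ^ 3)) has_integral
      - integral {arctan (1 / k)..pi / 2} f) {0..1}"
    by simp
  from has_integral_diff[OF I1 this]
  have "((\<lambda>p. k / B p * (1 / z p ^ 3) - (- k / A p) * (z p ^ 3 / k ^ 3)) has_integral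
      (integral {0..arctan (1 / k)} f + integral {arctan (1 / k)..pi / 2} f)) {0..1}"
    by simp
  also have "integral {0..arctan (1 / k)} f + integral {arctan (1 / k)..pi / 2} f
      = integral {0..pi / 2} f"
    using k by (intro Henstock_Kurzweil_Integration.integral_combine integrable_continuous_real cont_f)
      (use arctan_ubound[of "1 / k"] in auto)
  also have "(\<lambda>p. k / B p * (1 / z p ^ 3) - (- k / A p) * (z p ^ 3 / k ^ 3)) = E"
  proof
    fix p
    have A: "A p = z p ^ 4 * B p / k\<^sup>2"
      using z4[of p] AB[of p] k by (simp add: field_simps)
    show "k / B p * (1 / z p ^ 3) - (- k / A p) * (z p ^ 3 / k ^ 3) = E p"
      unfolding E_def A using AB(2)[of p] z0[of p] k
      by (simp add: divide_simps) algebra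
  qed
  finally have I: "(E has_integral integral {0..pi / 2} f) {0..1}" .

  define s where "s = sqrt (2 * (1 + k\<^sup>2))"
  have s: "s > 0" "s\<^sup>2 = 2 * (1 + k\<^sup>2)" using k by (auto simp: s_def add_pos_pos)
  \<comment> \<open>The integrand \<open>E\<close> becomes elliptic in \<open>z - k/z\<close>; \<open>g\<close> is given by \<open>z - k/z = (1 - k) (1 - g\<^sup>2) / (1 + g\<^sup>2)\<close>.\<close>
  define N D z' where "N p = (1 - z p) * (z p + k)" and "D p = (1 + z p) * (z p - k)"
    and "z' p = - (k\<^sup>2 * p * (1 - k ^ 4) / (2 * (B p)\<^sup>2 * z p ^ 3))" for p
  define g where "g p = sqrt (N p / D p)" for p
  define g' where "g' p = - (2 * (1 - k) * (z p ^ 2 + k) / (D p)\<^sup>2 * z' p) / (2 * g p)" for p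
  \<comment> \<open>These two formulas place \<open>z p\<close> between \<open>k\<close> and 1.
    Moreover the product of their right-hand sides is the square of p k (1 - k^4) / B, which later
    removes the square root.\<close>
  have z4_le: "1 - z p ^ 4 = p\<^sup>2 * (1 - k ^ 4) / B p" for p
    unfolding z4 using AB(2)[of p] by (simp add: divide_simps) (simp add: A_def B_def; algebra)
  have z4_ge: "z p ^ 4 - k ^ 4 = k\<^sup>2 * (1 - k ^ 4) / B p" for p
    unfolding z4 using AB(2)[of p] by (simp add: divide_simps) (simp add: A_def B_def; algebra)
  have zk: "k < z p" for p
  proof (rule power_less_imp_less_base)
    have "0 < z p ^ 4 - k ^ 4"
      unfolding z4_ge using k k4 AB[of p] by simp
    then show "k ^ 4 < z p ^ 4" by simp
  qed (use z0[of p] in simp)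
  have z1: "z p \<le> 1" for p
  proof (rule power_le_imp_le_base)
    have "0 \<le> 1 - z p ^ 4"
      unfolding z4_le using k4 AB[of p] by simp
    then show "z p ^ Suc 3 \<le> 1 ^ Suc 3" by simp
  qed simp
  have z1': "z p < 1" if "p > 0" for p
  proof (rule power_less_imp_less_base)
    have "0 < 1 - z p ^ 4"
      unfolding z4_le using k4 AB[of p] that by simp
    then show "z p ^ 4 < 1 ^ 4" by simp
  qed simp
  \<comment> \<open>On [0,1] the path stays above the fixed point sqrt k. As D - N = 2 (z^2 - k),
    this means N <= D, hence g <= 1.\<close>
  have zz: "k \<le> (z p)\<^sup>2" if "p \<in> {0..1}" for p
  proof (rule power2_le_imp_le)
    have "0 \<le> (1 - k\<^sup>2) * (1 - p\<^sup>2)"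
      using k that by (intro mult_nonneg_nonneg) (auto simp: power_le_one)
    also have "\<dots> = A p - B p" by (simp add: A_def B_def algebra_simps)
    finally have "k\<^sup>2 \<le> k\<^sup>2 * (A p / B p)"
      using k AB[of p] by (simp add: pos_le_divide_eq mult_left_mono)
    then have "k\<^sup>2 \<le> z p ^ 4" by (simp add: z4)
    then show "k\<^sup>2 \<le> ((z p)\<^sup>2)\<^sup>2" by (simp flip: power_mult)
  qed simp
  have D: "D p > 0" for p using zk[of p] z0[of p] by (simp add: D_def)
  have N: "N p \<ge> 0" for p using z1[of p] z0[of p] k by (simp add: N_def)
  have N': "N p > 0" if "p > 0" for p using z1'[OF that] z0[of p] k by (simp add: N_def)
  have deriv_z: "(z has_real_derivative z' p) (at p within S)" for p S
  proof -
    have u: "((\<lambda>p. k\<^sup>2 * A p / B p) has_real_derivative (- 2 * k\<^sup>2 * p * (1 - k ^ 4) / (B p)\<^sup>2)) (at p)"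
      unfolding A_def B_def using AB(2)[of p]
      by (auto intro!: derivative_eq_intros simp: B_def divide_simps) algebra+
    have "(z has_real_derivative (1/4 * (k\<^sup>2 * A p / B p) powr (1/4 - 1) *
        (- 2 * k\<^sup>2 * p * (1 - k ^ 4) / (B p)\<^sup>2))) (at p)"
      unfolding z_def[abs_def]
      by (rule DERIV_cong[OF DERIV_fun_powr[OF u]]) (use AB[of p] k in auto)
    also have "(k\<^sup>2 * A p / B p) powr (1/4 - 1) = z p / z p ^ 4"
      unfolding z4 powr_diff using AB[of p] k by (simp add: z_def)
    also have "1/4 * (z p / z p ^ 4) * (- 2 * k\<^sup>2 * p * (1 - k ^ 4) / (B p)\<^sup>2) = z' p"
      unfolding z'_def using AB[of p] z0[of p] by (simp add: divide_simps) algebra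
    finally show ?thesis by (rule has_field_derivative_at_within)
  qed
  have "((\<lambda>p. g' p *\<^sub>R h (g p)) has_integral integral {g 0..g 1} h) {0..1}"
  \<comment> \<open>The point \<open>p = 0\<close> is left out: there \<open>N\<close> vanishes, so
    the chain rule for the square root does not apply and \<open>g'\<close> has a zero
    denominator.\<close>
  proof (rule has_integral_substitution_strong[of "{0}"])
    show "g ` {0..1} \<subseteq> {0..1}"
    proof safe
      fix p :: real assume "p \<in> {0..1}"
      then have "N p \<le> D p" using zz[of p] by (simp add: N_def D_def algebra_simps power2_eq_square)
      then show "g p \<in> {0..1}" using N[of p] D[of p] by (simp add: g_def)
    qed
    show "continuous_on {0..1} h"
      unfolding h_def[abs_def] using \<beta>
      by (intro continuous_intros) (auto simp: add_nonneg_pos intro!: less_imp_neq[symmetric])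
    show "continuous_on {0..1} g"
    proof -
      have "(1 + z p) * (z p - k) \<noteq> 0" for p
        using D[of p] unfolding D_def by (rule less_imp_neq[symmetric])
      then show ?thesis
        unfolding g_def[abs_def] N_def D_def
        by (intro continuous_intros DERIV_continuous_on[OF deriv_z] ballI)
    qed
    show "(g has_real_derivative g' p) (at p within {0..1})" if "p \<in> {0..1} - {0}" for p
    proof -
      have "((\<lambda>p. N p / D p) has_real_derivative
          (- (2 * (1 - k) * (z p ^ 2 + k) / (D p)\<^sup>2 * z' p))) (at p within {0..1})"
        unfolding N_def D_def using D[of p]
        by (auto intro!: derivative_eq_intros deriv_z simp: D_def divide_simps) algebra
      from DERIV_real_sqrt[THEN DERIV_chain2, OF _ this]
      show ?thesis
        using that N'[of p] D[of p] unfolding g_def[abs_def] g'_def by (simp add: field_simps)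
    qed
    show "g 0 \<le> g 1"
      using k N[of 1] D[of 1] by (simp add: g_def[of 0] N_def[of 0] z_def[of 0] A_def[of 0] B_def[of 0])
        (simp add: g_def)
  qed simp_all
  moreover have "g 0 = 0"
    using k by (simp add: g_def N_def z_def A_def B_def)
  moreover have "g 1 = 1"
  proof -
    have "(z 1 ^ 2)\<^sup>2 = k\<^sup>2"
      using AB[of 1] by (simp add: z4 A_def B_def add.commute flip: power_mult)
    then have "z 1 ^ 2 = k" using k by (simp only: power2_eq_iff_nonneg zero_le_power2 less_imp_le)
    then have "N 1 = D 1" by (simp add: N_def D_def algebra_simps power2_eq_square)
    then show ?thesis using D[of 1] by (simp add: g_def)
  qed
  ultimately have J: "((\<lambda>p. g' p * h (g p)) has_integral integral {0..1} h) {0..1}"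
    by simp
  have "g' p * h (g p) = k * s / 4 * E p" if p: "p \<in> {0..1} - {0}" for p
  proof -
    define q where "q = N p / D p"
    \<comment> \<open>\<open>X\<close> is the positive square root of 4q (q^2 + 2
      \<open>\<beta>\<close> q + 1), that is, the denominator 2 g sqrt(g^4 + 2
      \<open>\<beta>\<close> g^2 + 1) in closed form. It is rational in \<open>p\<close> and
      \<open>z p\<close> because the numerator is, up to constants, (1 - z^4) (z^4 - k^4).\<close>
    define X where "X = 4 * (1 - k) * p * k * (1 - k ^ 4) / (B p * (D p)\<^sup>2 * s)"
    have pos: "p > 0" "N p > 0" "D p > 0" "q > 0" "B p > 0" "z p > 0"
      using p N'[of p] D[of p] AB z0 by (auto simp: q_def)
    have X: "X > 0"
      using pos k k4 s by (simp add: X_def)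
    have g: "g p = sqrt q" by (simp add: g_def q_def)
    have "(1 + k\<^sup>2) * (4 * q * (q\<^sup>2 + 2 * \<beta> * q + 1))
        = 4 * q * ((1 + k\<^sup>2) * q\<^sup>2 + 4 * k * q + (1 + k\<^sup>2))"
    proof -
      have "1 + k\<^sup>2 \<noteq> 0"
        using zero_le_power2[of k] by linarith
      then have "(1 + k\<^sup>2) * \<beta> = 2 * k"
        by (simp add: \<beta>_def)
      then show ?thesis by algebra
    qed
    also have "\<dots> = 4 * (N p * D p) * ((1 + k\<^sup>2) * (N p)\<^sup>2 + 4 * k * N p * D p + (1 + k\<^sup>2) * (D p)\<^sup>2) / D p ^ 4"
      using pos by (simp add: q_def divide_simps) algebra
    also have "N p * D p = (1 - z p ^ 2) * (z p ^ 2 - k\<^sup>2)"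
      unfolding N_def D_def by algebra
    \<comment> \<open>This factorisation is what singles out the value of \<open>\<beta>\<close>:
      its factors 1 + z^2 and z^2 + k^2 complete those of \<open>N p * D p\<close> to differences of
      fourth powers.\<close>
    also have "(1 + k\<^sup>2) * (N p)\<^sup>2 + 4 * k * N p * D p + (1 + k\<^sup>2) * (D p)\<^sup>2
        = 2 * (1 - k)\<^sup>2 * ((1 + z p ^ 2) * (z p ^ 2 + k\<^sup>2))"
      unfolding N_def D_def by algebra
    also have "4 * ((1 - z p ^ 2) * (z p ^ 2 - k\<^sup>2)) * (2 * (1 - k)\<^sup>2 * ((1 + z p ^ 2) * (z p ^ 2 + k\<^sup>2)))
        = 8 * (1 - k)\<^sup>2 * ((1 - z p ^ 4) * (z p ^ 4 - k ^ 4))"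
      by algebra
    also have "\<dots> / D p ^ 4 = (1 + k\<^sup>2) * X\<^sup>2"
      unfolding z4_le z4_ge X_def power_divide power_mult_distrib s(2)
      using pos s by (simp add: divide_simps) algebra
    finally have X2: "4 * q * (q\<^sup>2 + 2 * \<beta> * q + 1) = X\<^sup>2"
      using zero_le_power2[of k] by auto
    have "2 * g p * sqrt (g p ^ 4 + 2 * \<beta> * (g p)\<^sup>2 + 1) = X"
    proof -
      have "g p ^ 4 = ((sqrt q)\<^sup>2)\<^sup>2"
        unfolding g by (simp flip: power_mult del: real_sqrt_pow2_iff)
      also have "\<dots> = q\<^sup>2"
        using pos by simp
      finally have "2 * g p * sqrt (g p ^ 4 + 2 * \<beta> * (g p)\<^sup>2 + 1) = sqrt (4 * q * (q\<^sup>2 + 2 * \<beta> * q + 1))"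
        using pos by (simp add: g real_sqrt_mult)
      then show ?thesis using X by (simp add: X2)
    qed
    then have "g' p * h (g p) = - (2 * (1 - k) * (z p ^ 2 + k) / (D p)\<^sup>2 * z' p) / X"
      by (simp add: g'_def h_def mult.assoc)
    also have "\<dots> = k * s / 4 * E p"
      unfolding X_def z'_def E_def using pos k k4 s
      by (simp add: divide_simps) (simp add: algebra_simps power2_eq_square)
    finally show ?thesis .
  qed
  then have "((\<lambda>p. k * s / 4 * E p) has_integral integral {0..1} h) {0..1}"
    by (intro has_integral_spike_finite[OF _ _ J, of "{0}"]) auto
  from has_integral_unique[OF this has_integral_mult_right[OF I]]
  have "integral {0..pi / 2} f = 4 / (k * s) * integral {0..1} h"
    using k s by (simp add: field_simps)
  then show ?thesis
    unfolding f_def[abs_def] h_def[abs_def] \<beta>_def s_def .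
qed

section \<open>The transformation of degree 5 to the lemniscatic case\<close>

text \<open>For t = N/D of degree 5, the identities N^4 + D^4 = Q P^2 and N' D - N D' = b P give dt
  / sqrt(1 + t^4) = b dr / sqrt(Q). Thus b = 5 h^2 - 10 is the multiplier of the
  transformation.\<close>

lemma integral_quintic_transformation:
  fixes h :: real
  assumes h: "h > 0" "h ^ 4 = 5"
  shows "integral {0..1} (\<lambda>r. 1 / sqrt (r ^ 4 + 2 * (108 * h - 48 * h ^ 3) * r\<^sup>2 + 1))
    = 1 / (5 * h\<^sup>2 - 10) * integral {0..1} (\<lambda>t. 1 / sqrt (1 + t ^ 4))"
proof -
  define \<beta> a b c d where "\<beta> = 108 * h - 48 * h ^ 3" and "a = 35 * h - 15 * h ^ 3"
    and "b = 5 * h\<^sup>2 - 10" and "c = 18 * h ^ 3 - 38 * h" and "d = 282 - 124 * h\<^sup>2"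
  note defs = \<beta>_def a_def b_def c_def d_def
  \<comment> \<open>\<open>D\<close> is \<open>N\<close> with its coefficients reversed, so r -> 1/r
    induces t -> 1/t; in particular t = 1 at r = 1.\<close>
  define N D where "N r = b * r + a * r ^ 3 + r ^ 5" and "D r = 1 + a * r\<^sup>2 + b * r ^ 4" for r
  define P Q where "P r = 1 + c * r\<^sup>2 + d * r ^ 4 + c * r ^ 6 + r ^ 8"
    and "Q r = r ^ 4 + 2 * \<beta> * r\<^sup>2 + 1" for r
  define f where "f t = 1 / sqrt (1 + t ^ 4)" for t :: real
  \<comment> \<open>Each of the four bounds on h^2 = sqrt 5 fixes the sign of one of the
    coefficients \<open>b\<close>, \<open>c\<close>, \<open>a\<close>, \<open>d\<close>, in this
    order.\<close>
  have h2: "2 < h\<^sup>2" "19 < 9 * h\<^sup>2" "3 * h\<^sup>2 < 7" "62 * h\<^sup>2 < 141"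
  proof -
    have "h\<^sup>2 = sqrt 5"
      using h by (intro real_sqrt_unique[symmetric]) (simp_all flip: power_mult)
    moreover have "19/9 < sqrt 5" "sqrt 5 < 141/62"
      by (rule real_less_rsqrt real_less_lsqrt; simp add: power2_eq_square)+
    ultimately show "2 < h\<^sup>2" "19 < 9 * h\<^sup>2" "3 * h\<^sup>2 < 7" "62 * h\<^sup>2 < 141" by linarith+
  qed
  have coeffs: "b > 0" "a > 0" "c > 0" "d > 0"
  proof -
    have "a = 5 * h * (7 - 3 * h\<^sup>2)" "c = 2 * h * (9 * h\<^sup>2 - 19)"
      by (simp_all add: a_def c_def algebra_simps power2_eq_square power3_eq_cube)
    then show "b > 0" "a > 0" "c > 0" "d > 0"
      using h2 h by (simp_all add: b_def d_def)
  qed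
  have D: "D r \<ge> 1" for r using coeffs by (simp add: D_def)
  have P: "P r > 0" for r using coeffs unfolding P_def by (intro add_pos_nonneg) auto
  define u where "u = h\<^sup>2"
  have u: "h * h = u" "u * u = 5"
    using h(2) by (simp_all add: u_def power2_eq_square power4_eq_xxxx mult.assoc)
  then have u': "h * (h * x) = u * x" "u * (u * x) = 5 * x" for x
    by (simp_all flip: mult.assoc)
  \<comment> \<open>Constants are reduced by h^2 = u and u^2 = 5; the forms with a trailing factor
    \<open>x\<close> act inside right-nested products.\<close>
  note reduce = power2_eq_square power3_eq_cube power4_eq_xxxx algebra_simps u u'
  \<comment> \<open>Coefficients of the even powers \<open>r\<^sup>2\<close> to \<open>r\<^bsup>10\<^esup>\<close> in \<open>quartic\<close>; both sides are palindromic of degree 20.\<close>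
  have "4 * a = 2 * c + 2 * \<beta>"
    and "6 * a\<^sup>2 + 4 * b + b ^ 4 = c\<^sup>2 + 2 * d + 4 * \<beta> * c + 1"
    and "4 * a ^ 3 + 12 * a * b + 4 * a * b ^ 3 = 4 * c + 2 * c * d + 2 * \<beta> * (c\<^sup>2 + 2 * d)"
    and "a ^ 4 + 12 * a\<^sup>2 * b + 6 * b\<^sup>2 + 6 * a\<^sup>2 * b\<^sup>2 + 4 * b ^ 3
      = 2 + d\<^sup>2 + 2 * c\<^sup>2 + 4 * \<beta> * (c + c * d) + c\<^sup>2 + 2 * d"
    and "8 * a ^ 3 * b + 24 * a * b\<^sup>2 = 4 * (c + c * d) + 2 * \<beta> * (2 + d\<^sup>2 + 2 * c\<^sup>2)"
    unfolding defs by (simp_all add: reduce)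
  then have quartic: "N r ^ 4 + D r ^ 4 = Q r * (P r)\<^sup>2" for r
    unfolding N_def D_def Q_def P_def by algebra
  \<comment> \<open>A double zero of N^4 + D^4 that is not common to \<open>N\<close> and
    \<open>D\<close> is a zero of the Wronskian, which explains the factor \<open>P\<close>. Both
    sides are palindromic of degree 8 with constant term \<open>b\<close>, so only the coefficients
    of r^2 and r^4 are compared.\<close>
  have "3 * a - a * b = b * c" "5 + a\<^sup>2 - 3 * b\<^sup>2 = b * d"
    unfolding defs by (simp_all add: reduce)
  then have wronskian: "(b + 3 * a * r\<^sup>2 + 5 * r ^ 4) * D r - N r * (2 * a * r + 4 * b * r ^ 3) = b * P r" for r
    unfolding N_def D_def P_def by algebra
  have "((\<lambda>r. (b * P r / (D r)\<^sup>2) *\<^sub>R f (N r / D r)) has_integral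
      integral {N 0 / D 0..N 1 / D 1} f) {0..1}"
  proof (rule has_integral_substitution)
    \<comment> \<open>A crude bound suffices here, because \<open>f\<close> is continuous on the
      whole line.\<close>
    show "(\<lambda>r. N r / D r) ` {0..1} \<subseteq> {0..b + a + 1}"
    proof safe
      fix r :: real assume r: "r \<in> {0..1}"
      have "0 \<le> N r" using r coeffs by (simp add: N_def)
      moreover have "N r \<le> b * 1 + a * 1 + 1"
        using r coeffs unfolding N_def
        by (intro add_mono mult_left_mono power_le_one) auto
      moreover have "N r / D r \<le> N r / 1"
        using D[of r] \<open>0 \<le> N r\<close> by (intro divide_left_mono) auto
      ultimately show "N r / D r \<in> {0..b + a + 1}"
        using D[of r] by simp
    qed
    show "continuous_on {0..b + a + 1} f"
      unfolding f_def[abs_def]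
      by (intro continuous_intros) (auto simp: add_pos_nonneg intro!: less_imp_neq[symmetric])
    show "((\<lambda>r. N r / D r) has_real_derivative b * P r / (D r)\<^sup>2) (at r within {0..1})" for r
    proof -
      have "(N has_real_derivative (b + 3 * a * r\<^sup>2 + 5 * r ^ 4)) (at r within {0..1})"
        unfolding N_def[abs_def] by (auto intro!: derivative_eq_intros)
      moreover have "(D has_real_derivative (2 * a * r + 4 * b * r ^ 3)) (at r within {0..1})"
        unfolding D_def[abs_def] by (auto intro!: derivative_eq_intros)
      ultimately show ?thesis
        using DERIV_divide[of N _ r _ D] D[of r] wronskian[of r] by (fastforce simp: power2_eq_square)
    qed
  qed (auto simp: N_def D_def add.commute add.left_commute)
  moreover have "N 0 / D 0 = 0" "N 1 / D 1 = 1"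
    using D[of 1] by (simp_all add: N_def D_def add_ac)
  moreover have "b * P r / (D r)\<^sup>2 * f (N r / D r) = b * (1 / sqrt (Q r))" for r
  proof -
    have "1 + (N r / D r) ^ 4 = Q r * (P r)\<^sup>2 / ((D r)\<^sup>2)\<^sup>2"
      using D[of r] by (simp add: quartic[symmetric] power_divide field_simps flip: power_mult)
    moreover have "sqrt (((D r)\<^sup>2)\<^sup>2) = (D r)\<^sup>2" by (rule real_sqrt_unique) simp_all
    ultimately have "f (N r / D r) = (D r)\<^sup>2 / (sqrt (Q r) * P r)"
      using P[of r] D[of r] by (simp only: f_def real_sqrt_divide real_sqrt_mult) simp
    then show ?thesis
      using P[of r] D[of r] by simp
  qed
  ultimately have "((\<lambda>r. b * (1 / sqrt (Q r))) has_integral integral {0..1} f) {0..1}"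
    by simp
  then have "b * integral {0..1} (\<lambda>r. 1 / sqrt (Q r)) = integral {0..1} f"
    by (simp only: integral_mult_right integral_unique flip: integral_mult_right)
  then show ?thesis
    using coeffs(1) unfolding Q_def f_def[abs_def] b_def \<beta>_def by (simp add: field_simps)
qed

section \<open>Evaluation at 1/81\<close>

theorem mainTheorem15:
  shows "hypergeom_2F1 (1/2) (3/4) 1 (1/81) =
    complex_of_real (9 / 100 * (sqrt 2 * 5 powr (3/4) * Gamma (1/4) ^ 2 / pi powr (3/2)))"
proof -
  define h :: real where "h = 5 powr (1/4)"
  \<comment> \<open>Chosen so that 1 - k^4 = 1 - 80/81 = 1/81.\<close>
  define k where "k = 2 * h / 3"
  have h: "h > 0" "h ^ 4 = 5"
  proof -
    have "h ^ 4 = h powr 4" by (simp add: h_def powr_numeral)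
    then show "h > 0" "h ^ 4 = 5" by (simp_all add: h_def powr_powr)
  qed
  have h5: "h * (h * (h * h)) = 5" using h by (simp add: power4_eq_xxxx mult.assoc)
  then have "h * (h * (h * (h * x))) = 5 * x" for x by (simp flip: mult.assoc)
  note reduce = h5 this power2_eq_square power3_eq_cube algebra_simps
  have h3: "5 powr (3/4) = h ^ 3"
  proof -
    have "h ^ 3 = h powr 3" by (simp add: h_def powr_numeral)
    then show ?thesis by (simp add: h_def powr_powr)
  qed
  have k4: "k ^ 4 = 80 / 81" by (simp add: k_def power_divide power_mult_distrib h)
  have k: "0 < k" "k < 1"
  proof -
    show "0 < k" using h by (simp add: k_def)
    show "k < 1" by (rule power_less_imp_less_base[of _ 4]) (simp_all add: k4)
  qed
  have h2: "2 < h\<^sup>2"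
    by (rule power_less_imp_less_base[of _ 2]) (simp_all add: h flip: power_mult)
  \<comment> \<open>As (2 + sqrt 5)^2 = 9 + 4 sqrt 5, the square root in the prefactor of the fold
    can be extracted.\<close>
  have k2: "1 + k\<^sup>2 = ((2 + h\<^sup>2) / 3)\<^sup>2"
    by (simp add: k_def power_divide power_mult_distrib divide_simps) (simp add: reduce)
  \<comment> \<open>The folded modulus is exactly that of the quintic transformation: 2k / (1 + k^2)
    = 12 h / (9 + 4 h^2), and 9 + 4 h^2 has inverse 9 - 4 h^2 because 81 - 16 h^4 = 1.\<close>
  have \<beta>: "2 * k / (1 + k\<^sup>2) = 108 * h - 48 * h ^ 3"
  proof -
    have "2 * k = (108 * h - 48 * h ^ 3) * (1 + k\<^sup>2)"
      by (simp add: k_def power_divide power_mult_distrib divide_simps) (simp add: reduce)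
    moreover have "1 + k\<^sup>2 > 0" by (simp add: add_pos_nonneg)
    ultimately show ?thesis by (simp add: field_simps)
  qed
  define F where "F = 9 / 100 * (sqrt 2 * 5 powr (3/4) * Gamma (1/4) ^ 2 / pi powr (3/2))"
  have "(\<lambda>n. pochhammer (1/2) n * pochhammer (3/4) n / (fact n * fact n) * (1/81) ^ n) sums
    (2 / pi * integral {0..pi/2} (\<lambda>t. (1 - (1 - k ^ 4) * (sin t)\<^sup>2) powr (- 3/4)))"
    using hypergeom_half_sums_integral[of "3/4" "1/81"] by (simp add: k4)
  also have "2 / pi * integral {0..pi/2} (\<lambda>t. (1 - (1 - k ^ 4) * (sin t)\<^sup>2) powr (- 3/4))
    = 2 / pi * (4 / (k * (sqrt 2 * ((2 + h\<^sup>2) / 3))) *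
        (1 / (5 * h\<^sup>2 - 10) * ((Gamma (1/4))\<^sup>2 / (8 * sqrt pi))))"
    unfolding integral_quadratic_fold[OF k] \<beta> integral_quintic_transformation[OF h] integral_lemniscate
    unfolding k2 using h2 by (simp add: real_sqrt_mult)
  also have "\<dots> = 2 / (k * ((2 + h\<^sup>2) / 3) * (5 * h\<^sup>2 - 10)) / (2 * sqrt 2) * ((Gamma (1/4))\<^sup>2 / (pi * sqrt pi))"
    by simp
  \<comment> \<open>Here (h^2 + 2) (h^2 - 2) = h^4 - 4 = 1, so only 5k/3 remains.\<close>
  also have "k * ((2 + h\<^sup>2) / 3) * (5 * h\<^sup>2 - 10) = 10 * h / 9"
    by (simp add: k_def divide_simps) (simp add: reduce)
  also have "2 / (10 * h / 9) = 9 / 25 * h ^ 3"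
    using h(1) by (simp add: divide_simps) (simp add: reduce)
  also have "pi * sqrt pi = pi powr (3/2)"
    using powr_add[of pi 1 "1/2"] by (simp add: powr_half_sqrt)
  also have "9 / 25 * h ^ 3 / (2 * sqrt 2) * ((Gamma (1/4))\<^sup>2 / pi powr (3/2)) = F"
    by (simp add: F_def h3 field_simps)
  finally have "(\<lambda>n. complex_of_real
      (pochhammer (1/2) n * pochhammer (3/4) n / (fact n * fact n) * (1/81) ^ n)) sums of_real F"
    by (rule sums_of_real)
  also have "(\<lambda>n. complex_of_real (pochhammer (1/2) n * pochhammer (3/4) n / (fact n * fact n) * (1/81) ^ n))
    = (\<lambda>n. pochhammer (1/2) n * pochhammer (3/4) n / (pochhammer 1 n * pochhammer 1 n) * (1/81) ^ n)"
    by (simp add: pochhammer_fact pochhammer_of_real[symmetric])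
  finally show ?thesis
    unfolding hypergeom_2F1_def F_def by (rule sums_unique[symmetric])
qed

end
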